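(* Let $p\ge -1$ be an integer. The polynomials $R_{N,n}$ satisfy the recurrence relation $$\begin{aligned} &2(n+1)\left(n+N+\tfrac p2+1\right)\left(2n+N+\tfrac p2\right)R_{N,n+1}(x)\\ &\quad=-\left(\left(2n+N+\tfrac p2+1\right)\left(N+\tfrac p2\right)^2+\left(2n+N+\tfrac p2\right)_3(1-2x^2)\right)R_{N,n}(x)\\ &\qquad-2n\left(n+N+\tfrac p2\right)\left(2n+N+\tfrac p2+2\right)R_{N,n-1}(x), \end{aligned}$$ for all $0\le x\le1$, every nonnegative integer $N$ and every positive integer $n$, where $(x)_n=x(x+1)(x+2)\cdots(x+n-1)$ for real $x$ and nonnegative integer $n$.
   Context: The radial Zernike polynomials $R_{N,n}$ for the unit ball in $\mathbb{R}^{p+2}$ are defined, for nonnegative integers $N,n$ and $0\le x\le1$, by $$R_{N,n}(x)=x^N\sum_{m=0}^n(-1)^m\binom{n+N+\frac p2}{m}\binom{n}{m}(x^2)^{n-m}(1-x^2)^m,$$ where $\binom{a}{m}=\frac{a(a-1)\cdots(a-m+1)}{m!}$ for real $a$ and nonnegative integer $m$. *)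

theory Defs
  imports Complex_Main
begin

text \<open>Radial Zernike polynomials for the unit ball in dimension \<open>p + 2\<close>; the arguments
  of \<open>zernike_R p N n x\<close> are the dimension parameter, the two indices and the radius.\<close>

definition zernike_R :: "int \<Rightarrow> nat \<Rightarrow> nat \<Rightarrow> real \<Rightarrow> real" where
  "zernike_R p N n x =
     x ^ N * (\<Sum>m=0..n. (-1) ^ m * ((real n + real N + real_of_int p / 2) gchoose m)
                 * real (n choose m) * (x\<^sup>2) ^ (n - m) * (1 - x\<^sup>2) ^ m)"

end

theory Submission
  imports Defs
begin

text \<open>
  Put \<open>c = N + p/2\<close>, \<open>u = x\<^sup>2\<close> and \<open>v = 1 - x\<^sup>2\<close>. Up to the factor \<open>x ^ N\<close>, the value
  \<open>R_{N,n}(x)\<close> is the binary form \<open>\<Sum>m. (-1)^m (n+c choose m) (n choose m) u^(n-m) v^m\<close>, which is the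
  Jacobi polynomial \<open>P_n = P_n^(0,c)\<close> at \<open>u - v = 2 x\<^sup>2 - 1\<close>; the claim is the classical three-term
  recurrence.

  Because \<open>u + v = 1\<close>, every term of the recurrence can be made homogeneous of degree \<open>n + 1\<close>
  by inserting powers of \<open>u + v\<close>: the coefficient of \<open>P_n\<close> becomes linear in \<open>u, v\<close> (note
  \<open>1 - 2 x\<^sup>2 = v - u\<close>), and that of \<open>P_{n-1}\<close> is multiplied by \<open>(u + v)\<^sup>2\<close>. In this form the
  recurrence holds for arbitrary \<open>u\<close> and \<open>v\<close>, coefficient by coefficient. Multiplication by \<open>u\<close>
  leaves the coefficients unchanged and multiplication by \<open>v\<close> shifts them by one
  (\<open>mult_fst_binary_form\<close>, \<open>mult_snd_binary_form\<close>), so a single identity between products of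
  binomial coefficients remains (\<open>jacobi_coeff_recurrence\<close>). The products occurring in
  it are explicit rational multiples of one of them, which turns it into a polynomial identity.
\<close>

section \<open>Binary forms and their coefficients\<close>

definition binary_form :: "'a::comm_ring_1 \<Rightarrow> 'a \<Rightarrow> nat \<Rightarrow> (nat \<Rightarrow> 'a) \<Rightarrow> 'a" where
  "binary_form u v d f = (\<Sum>m\<le>d. f m * u ^ (d - m) * v ^ m)"

definition shift_coeff :: "(nat \<Rightarrow> 'a::zero) \<Rightarrow> nat \<Rightarrow> 'a" where
  "shift_coeff f m = (case m of 0 \<Rightarrow> 0 | Suc j \<Rightarrow> f j)"

lemma shift_coeff_simps [simp]:
  "shift_coeff f 0 = 0" "shift_coeff f (Suc j) = f j"
  by (simp_all add: shift_coeff_def)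

text \<open>The sequence \<open>f\<close> may be defined beyond the degree, so its next entry has to vanish for it
  to be read as the coefficients of a form of one degree higher.\<close>

lemma mult_fst_binary_form:
  assumes "f (Suc d) = 0"
  shows "u * binary_form u v d f = binary_form u v (Suc d) f"
proof -
  have "u * binary_form u v d f = (\<Sum>m\<le>d. f m * u ^ (Suc d - m) * v ^ m)"
    unfolding binary_form_def sum_distrib_left
    by (rule sum.cong) (simp_all add: Suc_diff_le mult_ac)
  with assms show ?thesis
    by (simp add: binary_form_def)
qed

lemma mult_snd_binary_form:
  "v * binary_form u v d f = binary_form u v (Suc d) (shift_coeff f)"
  unfolding binary_form_def sum.atMost_Suc_shift sum_distrib_left
  by (simp add: mult_ac)

lemma binary_form_add:
  "binary_form u v d f + binary_form u v d g = binary_form u v d (\<lambda>m. f m + g m)"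
  by (simp add: binary_form_def sum.distrib algebra_simps)

lemma binary_form_scale:
  "a * binary_form u v d f = binary_form u v d (\<lambda>m. a * f m)"
  by (simp add: binary_form_def sum_distrib_left mult_ac)

lemma mult_sum_binary_form:
  assumes "f (Suc d) = 0"
  shows "(u + v) * binary_form u v d f = binary_form u v (Suc d) (\<lambda>m. f m + shift_coeff f m)"
  using assms by (simp add: distrib_right mult_fst_binary_form mult_snd_binary_form binary_form_add)

section \<open>The recurrence for the coefficients\<close>

definition jacobi_coeff :: "real \<Rightarrow> real \<Rightarrow> nat \<Rightarrow> real" where
  "jacobi_coeff y z m = (-1) ^ m * (y gchoose m) * (z gchoose m)"

lemma gbinomial_Suc_right:
  fixes a :: "'a::field_char_0"
  shows "a gchoose Suc j = (a - of_nat j) / of_nat (Suc j) * (a gchoose j)"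
proof -
  have "of_nat (Suc j) * (a gchoose Suc j) = (a - of_nat j) * (a gchoose j)"
    using gbinomial_mult_1[of a j] by (simp add: algebra_simps)
  then show ?thesis
    using of_nat_neq_0[of j, where 'a='a] by (simp add: divide_simps mult_ac del: of_nat_Suc)
qed

lemma gbinomial_Suc_both:
  fixes a :: "'a::field_char_0"
  shows "(a + 1) gchoose Suc j = (a + 1) / of_nat (Suc j) * (a gchoose j)"
  using gbinomial_absorption'[of "Suc j" "a + 1"] by simp

lemma jacobi_coeff_Suc_right:
  "jacobi_coeff y z (Suc j) =
     - ((y - real j) * (z - real j) / (real j + 1)\<^sup>2) * jacobi_coeff y z j"
  by (simp add: jacobi_coeff_def gbinomial_Suc_right power2_eq_square divide_simps
      add.commute mult_ac)

lemma jacobi_coeff_Suc_both: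
  "jacobi_coeff (y + 1) (z + 1) (Suc j) =
     - ((y + 1) * (z + 1) / (real j + 1)\<^sup>2) * jacobi_coeff y z j"
  by (simp add: jacobi_coeff_def gbinomial_Suc_both power2_eq_square divide_simps mult_ac)
    (simp add: add.commute)

text \<open>
  Here \<open>q0\<close>, \<open>q1\<close> and \<open>q2\<close> are the coefficients of \<open>P_{n-1}\<close>, \<open>P_n\<close> and \<open>P_{n+1}\<close> when
  \<open>z = n - 1\<close> and \<open>y = n - 1 + c\<close>. In \<open>y\<close> and \<open>z\<close> the recurrence is symmetric:
  \<open>c = y - z\<close> and \<open>2 n + c = y + z + 2\<close>.
\<close>

lemma jacobi_coeff_recurrence:
  fixes y z :: real
  defines "q0 \<equiv> jacobi_coeff y z"
    and "q1 \<equiv> jacobi_coeff (y + 1) (z + 1)"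
    and "q2 \<equiv> jacobi_coeff (y + 2) (z + 2)"
  shows "2 * (z + 2) * (y + 2) * (y + z + 2) * q2 m =
      - ((y + z + 3) * (y - z)\<^sup>2 * (q1 m + shift_coeff q1 m)
          + (y + z + 2) * (y + z + 3) * (y + z + 4) * (shift_coeff q1 m - q1 m))
      - 2 * (z + 1) * (y + 1) * (y + z + 4)
          * (q0 m + 2 * shift_coeff q0 m + shift_coeff (shift_coeff q0) m)"
proof -
  consider "m = 0" | "m = Suc 0" | j where "m = Suc (Suc j)"
    by (metis not0_implies_Suc)
  then show ?thesis
  proof cases
    case 1
    show ?thesis
      unfolding 1 by (simp add: q0_def q1_def q2_def jacobi_coeff_def) algebra
  next
    case 2
    show ?thesis
      unfolding 2 by (simp add: q0_def q1_def q2_def jacobi_coeff_def) algebra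
  next
    case (3 j)
    define g r where "g = q0 j" and "r = real j + 1"
    have nz: "r \<noteq> 0" "r + 1 \<noteq> 0"
      unfolding r_def by linarith+
    have q0_1: "q0 (Suc j) = - ((y - r + 1) * (z - r + 1) / r\<^sup>2) * g"
      by (simp add: q0_def g_def r_def jacobi_coeff_Suc_right)
    have q0_2: "q0 (Suc (Suc j)) = - ((y - r) * (z - r) / (r + 1)\<^sup>2) * q0 (Suc j)"
      using jacobi_coeff_Suc_right[of y z "Suc j"] by (simp add: q0_def r_def algebra_simps)
    have q1_1: "q1 (Suc j) = - ((y + 1) * (z + 1) / r\<^sup>2) * g"
      by (simp add: q0_def q1_def g_def r_def jacobi_coeff_Suc_both)
    have q1_2: "q1 (Suc (Suc j)) = - ((y - r + 1) * (z - r + 1) / (r + 1)\<^sup>2) * q1 (Suc j)"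
      using jacobi_coeff_Suc_right[of "y + 1" "z + 1" "Suc j"]
      by (simp add: q1_def r_def algebra_simps)
    have q2_2: "q2 (Suc (Suc j)) = - ((y + 2) * (z + 2) / (r + 1)\<^sup>2) * q1 (Suc j)"
      using jacobi_coeff_Suc_both[of "y + 1" "z + 1" "Suc j"]
      by (simp add: q1_def q2_def r_def algebra_simps)
    \<comment> \<open>The common denominator of the coefficients is \<open>r\<^sup>2 (r + 1)\<^sup>2\<close>; as multiples of
      \<open>h\<close> they are polynomials.\<close>
    define h where "h = g / (r\<^sup>2 * (r + 1)\<^sup>2)"
    have g: "g = r\<^sup>2 * (r + 1)\<^sup>2 * h"
      using nz by (simp add: h_def)
    then have q_1:
      "q0 (Suc j) = - ((y - r + 1) * (z - r + 1) * (r + 1)\<^sup>2 * h)"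
      "q1 (Suc j) = - ((y + 1) * (z + 1) * (r + 1)\<^sup>2 * h)"
      using nz by (simp_all add: q0_1 q1_1)
    then have q_2:
      "q0 (Suc (Suc j)) = (y - r) * (z - r) * (y - r + 1) * (z - r + 1) * h"
      "q1 (Suc (Suc j)) = (y - r + 1) * (z - r + 1) * (y + 1) * (z + 1) * h"
      "q2 (Suc (Suc j)) = (y + 2) * (z + 2) * (y + 1) * (z + 1) * h"
      using nz by (simp_all add: q0_2 q1_2 q2_2)
    show ?thesis
      unfolding 3 shift_coeff_simps q_1 q_2 g_def[symmetric] unfolding g by algebra
  qed
qed

section \<open>The recurrence for the forms\<close>

lemma jacobi_form_recurrence:
  fixes c u v :: real and k :: nat
  defines "y \<equiv> real k + c" and "z \<equiv> real k"
  defines "P0 \<equiv> binary_form u v k (jacobi_coeff y z)"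
    and "P1 \<equiv> binary_form u v (Suc k) (jacobi_coeff (y + 1) (z + 1))"
    and "P2 \<equiv> binary_form u v (Suc (Suc k)) (jacobi_coeff (y + 2) (z + 2))"
  shows "2 * (z + 2) * (y + 2) * (y + z + 2) * P2 =
      - ((y + z + 3) * (y - z)\<^sup>2 * (u + v)
          + (y + z + 2) * (y + z + 3) * (y + z + 4) * (v - u)) * P1
      - 2 * (z + 1) * (y + 1) * (y + z + 4) * (u + v)\<^sup>2 * P0"
proof -
  define q0 q1 q2 where "q0 = jacobi_coeff y z"
    and "q1 = jacobi_coeff (y + 1) (z + 1)" and "q2 = jacobi_coeff (y + 2) (z + 2)"
  let ?F = "binary_form u v (Suc (Suc k))"
  have vanish: "jacobi_coeff a (real i) j = 0" if "i < j" for a i j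
    using that by (simp add: jacobi_coeff_def binomial_gbinomial[symmetric])
  have q0_0: "q0 (Suc k) = 0" "q0 (Suc (Suc k)) = 0"
    unfolding q0_def z_def by (simp_all add: vanish)
  have q1_0: "q1 (Suc (Suc k)) = 0"
    using vanish[of "Suc k" "Suc (Suc k)"] by (simp add: q1_def z_def add.commute)
  have uP1: "u * P1 = ?F q1" and vP1: "v * P1 = ?F (shift_coeff q1)"
    using q1_0 unfolding P1_def q1_def by (simp_all add: mult_fst_binary_form mult_snd_binary_form)
  have "(u + v)\<^sup>2 * P0 = (u + v) * binary_form u v (Suc k) (\<lambda>m. q0 m + shift_coeff q0 m)"
    using q0_0 unfolding P0_def q0_def by (simp add: power2_eq_square mult_sum_binary_form mult.assoc)
  also have "\<dots> = ?F (\<lambda>m. q0 m + shift_coeff q0 m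
                        + shift_coeff (\<lambda>m. q0 m + shift_coeff q0 m) m)"
    using q0_0 by (simp add: mult_sum_binary_form)
  also have "(\<lambda>m. q0 m + shift_coeff q0 m + shift_coeff (\<lambda>m. q0 m + shift_coeff q0 m) m)
      = (\<lambda>m. q0 m + 2 * shift_coeff q0 m + shift_coeff (shift_coeff q0) m)"
    by (auto simp: shift_coeff_def split: nat.split)
  finally have P0: "(u + v)\<^sup>2 * P0
      = ?F (\<lambda>m. q0 m + 2 * shift_coeff q0 m + shift_coeff (shift_coeff q0) m)" .
  define A B D E where "A = 2 * (z + 2) * (y + 2) * (y + z + 2)"
    and "B = (y + z + 3) * (y - z)\<^sup>2" and "D = (y + z + 2) * (y + z + 3) * (y + z + 4)"
    and "E = 2 * (z + 1) * (y + 1) * (y + z + 4)"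
  have "A * q2 m = (D - B) * q1 m + (- B - D) * shift_coeff q1 m
      + - E * (q0 m + 2 * shift_coeff q0 m + shift_coeff (shift_coeff q0) m)" for m
    using jacobi_coeff_recurrence[of z y m]
    unfolding A_def[symmetric] B_def[symmetric] D_def[symmetric] E_def[symmetric]
      q0_def[symmetric] q1_def[symmetric] q2_def[symmetric]
    by (simp add: algebra_simps)
  then have "A * P2 = (D - B) * (u * P1) + (- B - D) * (v * P1) + - E * ((u + v)\<^sup>2 * P0)"
    unfolding uP1 vP1 P0 P2_def q2_def[symmetric] binary_form_scale binary_form_add by simp
  then show ?thesis
    unfolding A_def[symmetric] B_def[symmetric] D_def[symmetric] E_def[symmetric]
    by (simp add: algebra_simps)
qed

lemma zernike_R_eq_binary_form:
  "zernike_R p N n x = x ^ N * binary_form (x\<^sup>2) (1 - x\<^sup>2) n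
     (jacobi_coeff (real n + (real N + real_of_int p / 2)) (real n))"
  by (simp add: zernike_R_def binary_form_def jacobi_coeff_def atLeast0AtMost
      binomial_gbinomial add.assoc)

theorem lemma8p1:
  fixes p :: int and N n :: nat and x :: real
  assumes "p \<ge> -1" and "n \<ge> 1" and "0 \<le> x" and "x \<le> 1"
  shows "2 * (real n + 1) * (real n + real N + real_of_int p / 2 + 1)
           * (2 * real n + real N + real_of_int p / 2) * zernike_R p N (n + 1) x
       = - ((2 * real n + real N + real_of_int p / 2 + 1) * (real N + real_of_int p / 2)\<^sup>2
            + pochhammer (2 * real n + real N + real_of_int p / 2) 3 * (1 - 2 * x\<^sup>2))
           * zernike_R p N n x
         - 2 * real n * (real n + real N + real_of_int p / 2)
           * (2 * real n + real N + real_of_int p / 2 + 2) * zernike_R p N (n - 1) x"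
proof -
  obtain k where n: "n = Suc k"
    using assms(2) by (cases n) auto
  define c where "c = real N + real_of_int p / 2"
  define y z t where "y = real k + c" and "z = real k" and "t = x ^ N"
  define P0 P1 P2 where "P0 = binary_form (x\<^sup>2) (1 - x\<^sup>2) k (jacobi_coeff y z)"
    and "P1 = binary_form (x\<^sup>2) (1 - x\<^sup>2) (Suc k) (jacobi_coeff (y + 1) (z + 1))"
    and "P2 = binary_form (x\<^sup>2) (1 - x\<^sup>2) (Suc (Suc k)) (jacobi_coeff (y + 2) (z + 2))"
  have rec: "2 * (z + 2) * (y + 2) * (y + z + 2) * P2 =
      - ((y + z + 3) * (y - z)\<^sup>2 + (y + z + 2) * (y + z + 3) * (y + z + 4) * (1 - 2 * x\<^sup>2)) * P1
      - 2 * (z + 1) * (y + 1) * (y + z + 4) * P0"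
    using jacobi_form_recurrence[of k c "x\<^sup>2" "1 - x\<^sup>2"]
    by (simp add: P0_def P1_def P2_def y_def z_def)
  have R: "zernike_R p N (n - 1) x = t * P0" "zernike_R p N n x = t * P1"
    "zernike_R p N (n + 1) x = t * P2"
    by (simp_all add: zernike_R_eq_binary_form n P0_def P1_def P2_def y_def z_def c_def t_def add_ac)
  have params: "real n + real N + real_of_int p / 2 = y + 1"
    "2 * real n + real N + real_of_int p / 2 = y + z + 2" "real N + real_of_int p / 2 = y - z"
    by (simp_all add: n y_def z_def c_def)
  have n_z: "real n = z + 1"
    by (simp add: n z_def)
  have poch: "pochhammer (y + z + 2) 3 = (y + z + 2) * (y + z + 3) * (y + z + 4)"
    by (simp add: pochhammer_rec numeral_3_eq_3 algebra_simps)
  show ?thesis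
    unfolding R params unfolding n_z poch using rec by algebra
qed

end
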